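(* Let $k\geq 1$ and $n$ be integers with $k\leq n\leq 2k+1$. Then the Kneser graph $K(n,k)$ is semi-transitive.
   Context: For integers $k\geq 1$ and $n\geq k$, the Kneser graph $K(n,k)$ is the simple undirected graph whose vertices are the $k$-element subsets of $[n]=\{1,2,\ldots,n\}$, where two distinct vertices are adjacent if and only if the corresponding subsets are disjoint. An orientation of a simple undirected graph (a choice of exactly one direction for each edge) is semi-transitive if it is acyclic (has no directed cycles) and, for any directed path $v_0\rightarrow v_1\rightarrow\cdots\rightarrow v_k$, either there is no edge between $v_0$ and $v_k$, or $v_i\rightarrow v_j$ is an edge for all $0\leq i<j\leq k$ (here $k$ denotes the length of the path). An undirected graph is semi-transitive if it admits a semi-transitive orientation. *)

theory Defs
  imports "Graph_Theory.Graph_Theory"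
begin

text \<open>
  Following \<^theory>\<open>Graph_Theory.Pair_Digraph\<close>, a simple undirected graph is a loop-free symmetric
  digraph whose arcs are ordered pairs: an undirected edge is a pair of mutually inverse arcs.
\<close>

definition kneser_graph :: "nat \<Rightarrow> nat \<Rightarrow> nat set pair_pre_digraph" where
  "kneser_graph n k =
    \<lparr> pverts = {A. A \<subseteq> {1..n} \<and> card A = k},
      parcs = {(A, B). A \<subseteq> {1..n} \<and> card A = k \<and> B \<subseteq> {1..n} \<and> card B = k
                        \<and> A \<noteq> B \<and> A \<inter> B = {}} \<rparr>"

lemma pair_graph_kneser_graph: "pair_graph (kneser_graph n k)"
proof -
  let ?G = "kneser_graph n k"
  have arc: "fst e \<in> pverts ?G \<and> snd e \<in> pverts ?G \<and> fst e \<noteq> snd e" if "e \<in> parcs ?G" for e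
    using that by (cases e) (simp add: kneser_graph_def)
  have fin: "finite (pverts ?G)"
    by (simp add: kneser_graph_def)
  have "parcs ?G \<subseteq> pverts ?G \<times> pverts ?G"
    using arc by (auto simp: mem_Times_iff)
  then have fin': "finite (parcs ?G)"
    using fin by (rule finite_subset[OF _ finite_cartesian_product]) (rule fin)
  have sym: "symmetric (with_proj ?G)"
    unfolding symmetric_def with_proj_simps by (rule symI) (simp add: kneser_graph_def Int_commute, blast)
  show ?thesis
    apply unfold_locales
    subgoal using arc by simp
    subgoal using arc by simp
    subgoal by (rule fin)
    subgoal by (rule fin')
    subgoal using arc by simp
    subgoal by (rule sym)
    done
qed

definition orientation_of :: "'a pair_pre_digraph \<Rightarrow> 'a pair_pre_digraph \<Rightarrow> bool" where
  "orientation_of D G \<longleftrightarrow>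
     pverts D = pverts G \<and> parcs D \<subseteq> parcs G \<and>
     (\<forall>u v. (u, v) \<in> parcs G \<longrightarrow> ((u, v) \<in> parcs D \<longleftrightarrow> (v, u) \<notin> parcs D))"

definition semi_transitive_orientation :: "'a pair_pre_digraph \<Rightarrow> 'a pair_pre_digraph \<Rightarrow> bool" where
  "semi_transitive_orientation D G \<longleftrightarrow>
     orientation_of D G \<and>
     (\<nexists>c. pre_digraph.cycle (with_proj D) c) \<and>
     (\<forall>p. vpath p (with_proj D) \<longrightarrow>
        (hd p, last p) \<notin> parcs G \<or>
        (\<forall>i j. i < j \<and> j < length p \<longrightarrow> (p ! i, p ! j) \<in> parcs D))"

definition semi_transitive_graph :: "'a pair_pre_digraph \<Rightarrow> bool" where
  "semi_transitive_graph G \<longleftrightarrow> (\<exists>D. semi_transitive_orientation D G)"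

end

theory Submission
  imports Defs
begin

text \<open>
  For $n \<le> 2k+1$ the Kneser graph $K(n,k)$ is 3-colourable: put the sets containing 1 in the first
  class, the remaining sets containing 2 in the second and all others in the third. Each of the
  first two classes has a common element, and the third consists of $k$-subsets of $\{3,\dots,n\}$,
  which has fewer than $2k$ elements, so no class contains two disjoint sets
  (\<open>kneser_colour_proper\<close>).

  Every 3-colourable graph is semi-transitive (\<open>three_colourable_imp_semi_transitive\<close>): direct
  each edge from the smaller to the larger colour. Colours strictly increase along directed walks,
  so there are no cycles, and a directed path has at most three vertices $v_0, v_1, v_2$. If
  $v_0$ and $v_2$ are adjacent, their edge is directed from $v_0$ to $v_2$, as the colours demand.
\<close>

definition colour_orientation :: "('a \<Rightarrow> nat) \<Rightarrow> 'a pair_pre_digraph \<Rightarrow> 'a pair_pre_digraph" where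
  "colour_orientation c G =
     \<lparr> pverts = pverts G, parcs = {(u, v). (u, v) \<in> parcs G \<and> c u < c v} \<rparr>"

lemma pverts_colour_orientation [simp]: "pverts (colour_orientation c G) = pverts G"
  by (simp add: colour_orientation_def)

lemma in_parcs_colour_orientation [simp]:
  "(u, v) \<in> parcs (colour_orientation c G) \<longleftrightarrow> (u, v) \<in> parcs G \<and> c u < c v"
  by (simp add: colour_orientation_def)

lemma orientation_of_colour_orientation:
  assumes "symmetric (with_proj G)"
    and "\<And>u v. (u, v) \<in> parcs G \<Longrightarrow> c u \<noteq> c v"
  shows "orientation_of (colour_orientation c G) G"
proof -
  have "(v, u) \<in> parcs G" if "(u, v) \<in> parcs G" for u v
    using assms(1) that by (auto simp: symmetric_def dest: symD)
  then show ?thesis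
    using assms(2) by (auto simp: orientation_of_def colour_orientation_def not_less le_less)
qed

lemma colour_le_along_arc_walk:
  assumes "pre_digraph.awalk (with_proj (colour_orientation c G)) u p v"
  shows "c u + length p \<le> c v"
proof -
  have "set p \<subseteq> parcs (colour_orientation c G)" "pcas u p v"
    using assms by (simp_all add: pre_digraph.awalk_def cas_with_proj_eq)
  then show ?thesis
  proof (induct p arbitrary: u)
    case (Cons e p)
    then have "c u < c (snd e)" and "c (snd e) + length p \<le> c v"
      by (auto simp: colour_orientation_def)
    then show ?case by simp
  qed simp
qed

lemma colour_orientation_acyclic:
  "\<not> pre_digraph.cycle (with_proj (colour_orientation c G)) p"
proof
  assume "pre_digraph.cycle (with_proj (colour_orientation c G)) p"
  then obtain u where "pre_digraph.awalk (with_proj (colour_orientation c G)) u p u" "p \<noteq> []"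
    by (auto simp: pre_digraph.cycle_def)
  then show False
    using colour_le_along_arc_walk[of c G u p u] by simp
qed

theorem three_colourable_imp_semi_transitive:
  fixes c :: "'a \<Rightarrow> nat"
  assumes sym: "symmetric (with_proj G)"
    and proper: "\<And>u v. (u, v) \<in> parcs G \<Longrightarrow> c u \<noteq> c v"
    and three: "\<And>v. v \<in> pverts G \<Longrightarrow> c v < 3"
  shows "semi_transitive_graph G"
proof -
  let ?D = "colour_orientation c G"
  have transitive_path: "(p ! i, p ! j) \<in> parcs ?D"
    if path: "vpath p (with_proj ?D)" and chord: "(hd p, last p) \<in> parcs G"
      and ij: "i < j" "j < length p" for p i j
  proof -
    consider x y where "p = [x, y]" | x y z where "p = [x, y, z]"
      | x y z w q where "p = x # y # z # w # q"
      using ij by (cases p rule: remdups_adj.cases) (auto, metis list.exhaust)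
    then show ?thesis
    proof cases
      case (1 x y)
      with path ij show ?thesis
        by (auto simp: vpath_def vwalk_def less_Suc_eq)
    next
      case (2 x y z)
      with path chord ij show ?thesis
        by (auto simp: vpath_def vwalk_def less_Suc_eq)
    next
      case (3 x y z w q)
      with path have "c x < c y" "c y < c z" "c z < c w" "c w < 3"
        by (auto simp: vpath_def vwalk_def three)
      then show ?thesis by simp
    qed
  qed
  have "semi_transitive_orientation ?D G"
    unfolding semi_transitive_orientation_def
    using orientation_of_colour_orientation[of G c] sym proper colour_orientation_acyclic[of c G]
      transitive_path by blast
  then show ?thesis
    by (auto simp: semi_transitive_graph_def)
qed

definition kneser_colour :: "nat set \<Rightarrow> nat" where
  "kneser_colour A = (if 1 \<in> A then 0 else if 2 \<in> A then 1 else 2)"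

text \<open>
  The pigeonhole bound $n - 2 < 2k$ is where both hypotheses enter: $k \<ge> 1$ makes it true
  even for $n \<le> 2$, when no elements remain after 1 and 2.
\<close>

lemma kneser_colour_proper:
  assumes "k \<ge> 1" and "n \<le> 2 * k + 1" and "(A, B) \<in> parcs (kneser_graph n k)"
  shows "kneser_colour A \<noteq> kneser_colour B"
proof
  assume same: "kneser_colour A = kneser_colour B"
  have A: "A \<subseteq> {1..n}" "card A = k" and B: "B \<subseteq> {1..n}" "card B = k" and disj: "A \<inter> B = {}"
    using assms(3) by (auto simp: kneser_graph_def)
  have not_both: "\<not> (1 \<in> A \<and> 1 \<in> B)" "\<not> (2 \<in> A \<and> 2 \<in> B)"
    using disj by blast+
  have avoid: "1 \<notin> A \<union> B" "2 \<notin> A \<union> B"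
    using same not_both by (simp_all add: kneser_colour_def split: if_split_asm)
  have "A \<union> B \<subseteq> {3..n}"
  proof
    fix x assume x: "x \<in> A \<union> B"
    then have "1 \<le> x" "x \<le> n" "x \<noteq> 1" "x \<noteq> 2"
      using A B avoid by auto
    then show "x \<in> {3..n}" by simp
  qed
  then have "card (A \<union> B) \<le> n - 2"
    using card_mono[of "{3..n}" "A \<union> B"] by simp
  moreover have "card (A \<union> B) = 2 * k"
    using A B disj by (simp add: card_Un_disjoint finite_subset)
  ultimately show False
    using assms(1,2) by simp
qed

theorem theorem9:
  fixes n k :: nat
  assumes "k \<ge> 1" and "k \<le> n" and "n \<le> 2 * k + 1"
  shows "semi_transitive_graph (kneser_graph n k)"
proof (rule three_colourable_imp_semi_transitive)
  interpret pair_graph "kneser_graph n k"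
    by (rule pair_graph_kneser_graph)
  show "symmetric (with_proj (kneser_graph n k))"
    by (rule pair_sym_arcs)
  show "kneser_colour A \<noteq> kneser_colour B" if "(A, B) \<in> parcs (kneser_graph n k)" for A B
    using assms(1,3) that by (rule kneser_colour_proper)
  show "kneser_colour A < 3" for A
    by (simp add: kneser_colour_def)
qed

end
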